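(* Let $\varphi_S(z)=1+\sin z$ and $\varphi_{\tanh}(z)=1+\tanh z$ for $z\in\mathbb D$. Then the sharp $\mathcal S^*(\varphi_{\tanh})$-radius of $\mathcal S^*(\varphi_S)$ is $$R_{\mathcal S^*(\varphi_{\tanh})}(\mathcal S^*(\varphi_S))=\arcsin(\tanh1).$$
   Context: Let $\mathbb D=\{z\in\mathbb C:|z|<1\}$ and let $\mathcal A$ be the class of functions $f$ analytic on $\mathbb D$ with $f(0)=0$ and $f'(0)=1$. For an analytic function $\varphi$ on $\mathbb D$ with $\varphi(0)=1$, the class $\mathcal S^*(\varphi)$ consists of all $f\in\mathcal A$ with $zf'(z)/f(z)\prec\varphi(z)$; that is, there is an analytic $\omega:\mathbb D\to\mathbb D$ with $\omega(0)=0$ such that $zf'(z)/f(z)=\varphi(\omega(z))$ on $\mathbb D$ (the quotient takes the value $1$ at $z=0$, and $f$ has no other zeros). For two such functions $\varphi_1,\varphi_2$, the sharp $\mathcal S^*(\varphi_2)$-radius of $\mathcal S^*(\varphi_1)$ is $$R_{\mathcal S^*(\varphi_2)}(\mathcal S^*(\varphi_1))=\sup\left\{r\in(0,1]: f_r(z)=\tfrac{f(rz)}{r}\text{ belongs to }\mathcal S^*(\varphi_2)\text{ for every } f\in\mathcal S^*(\varphi_1)\right\}.$$ *)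

theory Defs
  imports "HOL-Complex_Analysis.Complex_Analysis"
begin

text \<open>
  Functions on the open unit disk are represented by total functions on \<^typ>\<open>complex\<close>;
  every notion below depends only on their values on the disk.
\<close>

abbreviation unit_disk :: "complex set" where
  "unit_disk \<equiv> ball 0 1"

definition class_A :: "(complex \<Rightarrow> complex) set" where
  "class_A = {f. f holomorphic_on unit_disk \<and> f 0 = 0 \<and> deriv f 0 = 1}"

definition subordinate :: "(complex \<Rightarrow> complex) \<Rightarrow> (complex \<Rightarrow> complex) \<Rightarrow> bool" where
  "subordinate g h \<longleftrightarrow>
     (\<exists>\<omega>. \<omega> holomorphic_on unit_disk \<and> \<omega> ` unit_disk \<subseteq> unit_disk \<and> \<omega> 0 = 0 \<and>
          (\<forall>z\<in>unit_disk. g z = h (\<omega> z)))"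

text \<open>
  The quotient \<open>z f'(z) / f(z)\<close>, with its removable singularity at \<open>0\<close> filled in
  by the value \<open>1\<close> that it has for \<open>f\<close> in \<^const>\<open>class_A\<close>.
\<close>

definition log_quotient :: "(complex \<Rightarrow> complex) \<Rightarrow> complex \<Rightarrow> complex" where
  "log_quotient f z = (if z = 0 then 1 else z * deriv f z / f z)"

text \<open>
  The condition that \<open>f\<close> has no zero other than \<open>0\<close> is explicit because
  division by zero is total.
\<close>

definition starlike_class :: "(complex \<Rightarrow> complex) \<Rightarrow> (complex \<Rightarrow> complex) set" where
  "starlike_class \<phi> =
     {f \<in> class_A. (\<forall>z\<in>unit_disk - {0}. f z \<noteq> 0) \<and> subordinate (log_quotient f) \<phi>}"

text \<open>
  \<open>starlike_radius \<phi>\<^sub>2 \<phi>\<^sub>1\<close> is the sharp radius of the class of \<open>\<phi>\<^sub>1\<close> with respect to the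
  class of \<open>\<phi>\<^sub>2\<close>.
\<close>

definition starlike_radius :: "(complex \<Rightarrow> complex) \<Rightarrow> (complex \<Rightarrow> complex) \<Rightarrow> real" where
  "starlike_radius \<phi>\<^sub>2 \<phi>\<^sub>1 =
     Sup {r::real. 0 < r \<and> r \<le> 1 \<and>
           (\<forall>f\<in>starlike_class \<phi>\<^sub>1.
              (\<lambda>z. f (of_real r * z) / of_real r) \<in> starlike_class \<phi>\<^sub>2)}"

definition phi_S :: "complex \<Rightarrow> complex" where
  "phi_S z = 1 + sin z"

definition phi_tanh :: "complex \<Rightarrow> complex" where
  "phi_tanh z = 1 + tanh z"

end

theory Submission
  imports Defs
begin

text \<open>
  Since \<open>(artanh \<circ> sin)' = 1 / cos\<close> and \<open>\<bar>cos w\<bar> \<ge> cos \<bar>w\<bar>\<close>, the branch \<open>g\<close> of \<open>artanh \<circ> sin\<close> at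
  \<open>0\<close> satisfies \<open>\<bar>g w\<bar> \<le> artanh (sin \<bar>w\<bar>)\<close>, which is less than \<open>1\<close> for
  \<open>\<bar>w\<bar> < arcsin (tanh 1)\<close>. If \<open>\<omega>\<close> is the Schwarz function of \<open>f\<close> with respect to \<open>1 + sin\<close>, then
  \<open>g (\<omega> (r z))\<close> is one of \<open>f (r z) / r\<close> with respect to \<open>1 + tanh\<close> for \<open>r = arcsin (tanh 1)\<close>.
  Sharpness is witnessed by the function with Schwarz function \<open>\<omega> z = z\<close>, because
  \<open>tanh w = tanh 1\<close> forces \<open>\<bar>w\<bar> \<ge> 1\<close>.
\<close>

section \<open>Real estimates for \<open>artanh\<close>, \<open>sin\<close> and the number
  \<open>arcsin (tanh 1)\<close>\<close>

lemma artanh_real_strict_mono: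
  fixes x y :: real
  assumes "-1 < x" "x < y" "y < 1"
  shows "artanh x < artanh y"
proof (rule DERIV_pos_imp_increasing[where f = artanh])
  fix t assume "x \<le> t" "t \<le> y"
  then have t: "\<bar>t\<bar> < 1" using assms by linarith
  then have "t\<^sup>2 < 1" by (simp add: abs_square_less_1)
  with t show "\<exists>d. (artanh has_real_derivative d) (at t) \<and> d > 0"
    by (intro exI[of _ "1 / (1 - t\<^sup>2)"]) (auto intro: artanh_real_has_field_derivative)
qed fact

lemma abs_sin_less_1:
  fixes t :: real
  assumes "\<bar>t\<bar> < pi / 2"
  shows "\<bar>sin t\<bar> < 1"
proof -
  have "cos t > 0" using assms by (intro cos_gt_zero_pi) auto
  then have "(sin t)\<^sup>2 < 1" by (simp add: sin_squared_eq)
  then show ?thesis by (simp add: abs_square_less_1)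
qed

lemma has_real_derivative_artanh_sin:
  fixes t :: real
  assumes "\<bar>t\<bar> < pi / 2"
  shows "((\<lambda>x. artanh (sin x)) has_real_derivative 1 / cos t) (at t within A)"
proof -
  have "cos t > 0" using assms by (intro cos_gt_zero_pi) auto
  moreover have "((\<lambda>x. artanh (sin x)) has_real_derivative 1 / (1 - (sin t)\<^sup>2) * cos t) (at t within A)"
    using abs_sin_less_1[OF assms]
    by (intro DERIV_chain2[OF artanh_real_has_field_derivative] derivative_eq_intros) auto
  moreover have "1 / (1 - (sin t)\<^sup>2) * cos t = 1 / cos t"
    using \<open>cos t > 0\<close> by (simp add: sin_squared_eq) (simp add: power2_eq_square)
  ultimately show ?thesis by simp
qed

lemma arcsin_tanh_1_pos: "0 < arcsin (tanh 1)"
  using arcsin_less_arcsin[of 0 "tanh 1"] tanh_real_lt_1[of 1] by simp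

lemma arcsin_tanh_1_less_pi_half: "arcsin (tanh 1) < pi / 2"
  using arcsin_lt_bounded[of "tanh 1"] tanh_real_bounds[of 1] by auto

text \<open>The radius must lie in (0,1]. The mean value theorem on [0,1] gives
  \<open>artanh (sin 1) = 1 / cos \<xi>\<close>, which is at least 1, so
  \<open>tanh 1 \<le> sin 1\<close>.\<close>

lemma arcsin_tanh_1_le_1: "arcsin (tanh 1) \<le> 1"
proof -
  have pi: "\<bar>t\<bar> < pi / 2" if "0 \<le> t" "t \<le> 1" for t :: real
    using that pi_gt3 by linarith
  have "\<exists>\<xi>>0. \<xi> < 1 \<and> artanh (sin 1) - artanh (sin 0) = (1 - 0) * (1 / cos \<xi> :: real)"
  proof (rule MVT2[where f = "\<lambda>x. artanh (sin x)"])
    fix t :: real assume "0 \<le> t" "t \<le> 1"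
    then show "((\<lambda>x. artanh (sin x)) has_real_derivative 1 / cos t) (at t)"
      by (intro has_real_derivative_artanh_sin pi)
  qed simp
  then obtain \<xi> :: real where \<xi>: "0 < \<xi>" "\<xi> < 1" "artanh (sin 1 :: real) = 1 / cos \<xi>"
    by auto
  have "cos \<xi> > 0" using pi[of \<xi>] \<xi> by (intro cos_gt_zero_pi) auto
  then have "artanh (sin 1 :: real) \<ge> artanh (tanh 1)"
    using \<xi> by (simp add: artanh_tanh_real)
  moreover have "- 1 < sin (1::real)" using abs_sin_less_1[OF pi[of 1]] by simp
  ultimately have "tanh 1 \<le> sin (1::real)"
    using artanh_real_strict_mono[of "sin 1" "tanh 1"] tanh_real_lt_1[of 1] by linarith
  then have "arcsin (tanh 1) \<le> arcsin (sin (1::real))"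
    using tanh_real_bounds[of 1] by (intro arcsin_le_arcsin) auto
  also have "\<dots> = 1" using pi[of 1] by (intro arcsin_sin) auto
  finally show ?thesis .
qed

section \<open>The holomorphic branch of artanh(sin w) at 0 and its growth\<close>

lemma cos_norm_le_norm_cos:
  fixes w :: complex
  assumes "cmod w \<le> pi"
  shows "cos (cmod w) \<le> cmod (cos w)"
proof -
  \<comment> \<open>\<open>cos\<close> decreases on [0, pi]; afterwards only the identity |cos w|^2
    = cos(Re w)^2 + sinh(Im w)^2 is needed.\<close>
  have "cos (cmod w) \<le> cos \<bar>Re w\<bar>"
    using assms abs_Re_le_cmod[of w] by (intro cos_monotone_0_pi_le) auto
  also have "\<dots> \<le> \<bar>cos (Re w)\<bar>" by simp
  also have "\<dots> \<le> cmod (cos w)"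
    by (rule power2_le_imp_le) (auto simp: norm_cos_squared)
  finally show ?thesis .
qed

text \<open>Taking \<open>g\<close> as a primitive of \<open>1 / cos\<close> avoids branches of the
  logarithm. The identity with \<open>tanh\<close> then follows from a differential equation, and
  the bound from integrating along rays.\<close>

lemma artanh_sin_branch:
  obtains g :: "complex \<Rightarrow> complex" where
    "g holomorphic_on ball 0 (pi / 2)" "g 0 = 0"
    "\<And>w. w \<in> ball 0 (pi / 2) \<Longrightarrow> tanh (g w) = sin w"
    "\<And>w. w \<in> ball 0 (pi / 2) \<Longrightarrow> cmod (g w) \<le> artanh (sin (cmod w))"
proof -
  define B where "B = ball (0::complex) (pi / 2)"
  have B: "convex B" "open B" "0 \<in> B" by (auto simp: B_def)
  have cos_pos: "cos (cmod w) > 0" if "w \<in> B" for w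
    using that norm_ge_zero[of w] pi_gt_zero
    by (intro cos_gt_zero_pi) (simp_all add: B_def del: norm_ge_zero)
  \<comment> \<open>Used twice: with \<open>cos_pos\<close> it excludes zeros of \<open>cos\<close>
    on \<open>B\<close>, and later it bounds the derivative of \<open>g\<close>.\<close>
  have cos_ge: "cos (cmod w) \<le> cmod (cos w)" if "w \<in> B" for w
    using that pi_gt_zero unfolding B_def mem_ball_0 by (intro cos_norm_le_norm_cos) linarith
  have nz: "cos w \<noteq> 0" if "w \<in> B" for w
    using cos_pos[OF that] cos_ge[OF that] by auto
  obtain h where h: "\<And>w. w \<in> B \<Longrightarrow> (h has_field_derivative 1 / cos w) (at w within B)"
  proof (rule holomorphic_convex_primitive')
    show "(\<lambda>w. 1 / cos w) holomorphic_on B"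
      using nz by (intro holomorphic_intros) auto
  qed (use B in auto)
  define g where "g w = h w - h 0" for w
  have g0: "g 0 = 0" by (simp add: g_def)
  have g: "(g has_field_derivative 1 / cos w) (at w)" if "w \<in> B" for w
  proof -
    have "(h has_field_derivative 1 / cos w) (at w)"
      using h[OF that] at_within_open[OF that \<open>open B\<close>] by simp
    from DERIV_diff[OF this DERIV_const[of "h 0"]] show ?thesis
      by (simp add: g_def[abs_def])
  qed
  have hol: "g holomorphic_on B"
    using g B by (auto simp: holomorphic_on_open)
  \<comment> \<open>The numerator N satisfies N' = -(sin w / cos w) N, as does \<open>cos\<close>,
    so the quotient is constant. Working with N rather than \<open>tanh (g w)\<close> postpones the
    question whether \<open>cosh (g w)\<close> vanishes.\<close>
  have "\<exists>c. \<forall>w\<in>B. (sin w * cosh (g w) - sinh (g w)) / cos w = c"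
  proof (rule has_field_derivative_zero_constant)
    fix w assume w: "w \<in> B"
    have sh: "((\<lambda>w. sinh (g w)) has_field_derivative cosh (g w) / cos w) (at w)"
      using has_field_derivative_sinh[OF g[OF w]] by simp
    have ch: "((\<lambda>w. cosh (g w)) has_field_derivative sinh (g w) / cos w) (at w)"
      using has_field_derivative_cosh[OF g[OF w]] by simp
    have "((\<lambda>w. (sin w * cosh (g w) - sinh (g w)) / cos w) has_field_derivative
        ((cos w * cosh (g w) + sinh (g w) / cos w * sin w - cosh (g w) / cos w) * cos w
          - (sin w * cosh (g w) - sinh (g w)) * (- sin w)) / (cos w * cos w)) (at w)"
      by (rule DERIV_divide[OF DERIV_diff[OF DERIV_mult[OF DERIV_sin ch] sh] DERIV_cos nz[OF w]])
    moreover have "(cos w * cosh (g w) + sinh (g w) / cos w * sin w - cosh (g w) / cos w) * cos w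
          - (sin w * cosh (g w) - sinh (g w)) * (- sin w) = (cos w * cos w + sin w * sin w) * cosh (g w) - cosh (g w)"
      using nz[OF w] by (simp add: algebra_simps del: sin_cos_squared_add3)
    ultimately show "((\<lambda>w. (sin w * cosh (g w) - sinh (g w)) / cos w) has_field_derivative 0)
        (at w within B)"
      by (simp add: sin_cos_squared_add3 has_field_derivative_at_within)
  qed fact
  then obtain c where c: "\<And>w. w \<in> B \<Longrightarrow> (sin w * cosh (g w) - sinh (g w)) / cos w = c"
    by blast
  have "c = 0" using c[OF B(3)] by (simp add: g0)
  have tanh: "tanh (g w) = sin w" if w: "w \<in> B" for w
  proof -
    have eq: "sinh (g w) = sin w * cosh (g w)"
      using c[OF w] nz[OF w] \<open>c = 0\<close> by simp
    \<comment> \<open>Otherwise \<open>sinh (g w)\<close> would vanish too, against cosh^2 = sinh^2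
      + 1.\<close>
    then have "cosh (g w) \<noteq> 0"
      using cosh_square_eq[of "g w"] by auto
    with eq show ?thesis by (simp add: tanh_def)
  qed
  have bound: "cmod (g w) \<le> artanh (sin (cmod w))" if w: "w \<in> B" for w
  proof (cases "w = 0")
    case False
    define u where "u = sgn w"
    have u: "cmod u = 1" using False by (simp add: u_def norm_sgn)
    have in_B: "t *\<^sub>R u \<in> B" if "0 \<le> t" "t \<le> cmod w" for t
      using that w u by (simp add: B_def)
    have lt: "\<bar>t\<bar> < pi / 2" if "0 \<le> t" "t \<le> cmod w" for t
      using that w by (simp add: B_def)
    have dg: "((\<lambda>t. g (t *\<^sub>R u)) has_vector_derivative u * (1 / cos (t *\<^sub>R u))) (at t)"
      if t: "0 \<le> t" "t \<le> cmod w" for t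
    proof -
      have "((\<lambda>t. t *\<^sub>R u) has_vector_derivative u) (at t)"
        by (auto intro!: derivative_eq_intros)
      from field_vector_diff_chain_at[OF this g[OF in_B[OF t]]] show ?thesis
        by (simp add: o_def)
    qed
    \<comment> \<open>Mean value inequality on the segment from 0 to \<open>w\<close>: the speed of
      \<open>g\<close> at distance t is at most \<open>1 / cos t\<close>, the derivative of
      \<open>artanh (sin t)\<close>.\<close>
    have "cmod (g (cmod w *\<^sub>R u) - g (0 *\<^sub>R u)) \<le> artanh (sin (cmod w)) - artanh (sin 0)"
    proof (rule differentiable_bound_general)
      show "0 < cmod w" using False by simp
      show "continuous_on {0..cmod w} (\<lambda>t. g (t *\<^sub>R u))"
        by (intro continuous_at_imp_continuous_on ballI has_vector_derivative_continuous[OF dg]) auto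
      show "continuous_on {0..cmod w} (\<lambda>t. artanh (sin t))"
      proof (intro continuous_at_imp_continuous_on ballI)
        fix t assume "t \<in> {0..cmod w}"
        then have "\<bar>t\<bar> < pi / 2" using lt by simp
        then show "isCont (\<lambda>t. artanh (sin t)) t"
          by (rule DERIV_isCont[OF has_real_derivative_artanh_sin])
      qed
    next
      fix t assume t: "0 < t" "t < cmod w"
      show "((\<lambda>t. g (t *\<^sub>R u)) has_vector_derivative u * (1 / cos (t *\<^sub>R u))) (at t)"
        using t by (intro dg) auto
      show "((\<lambda>t. artanh (sin t)) has_vector_derivative 1 / cos t) (at t)"
        using t has_real_derivative_artanh_sin[OF lt, of t]
        by (simp add: has_real_derivative_iff_has_vector_derivative)
      have "cmod (t *\<^sub>R u) = t" using t u by simp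
      then show "cmod (u * (1 / cos (t *\<^sub>R u))) \<le> 1 / cos t"
        using cos_ge[of "t *\<^sub>R u"] cos_pos[of "t *\<^sub>R u"] in_B[of t] t u
        by (simp add: norm_mult norm_divide frac_le)
    qed
    moreover have "cmod w *\<^sub>R u = w" by (simp add: u_def sgn_div_norm False)
    ultimately show ?thesis by (simp add: g0)
  qed (simp add: g0)
  show thesis using that hol g0 tanh bound unfolding B_def by blast
qed

text \<open>The solutions differ from 1 by multiples of i pi, since \<open>sinh (w - 1) = 0\<close>;
  hence they all have real part 1.\<close>

lemma norm_ge_1_if_tanh_eq_tanh_1:
  fixes w :: complex
  assumes "tanh w = of_real (tanh 1)"
  shows "1 \<le> cmod w"
proof -
  have t1: "(of_real (tanh 1) :: complex) = sinh 1 / cosh 1"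
    by (simp add: tanh_def sinh_field_def cosh_field_def flip: exp_of_real)
  have ch1: "cosh (1::complex) \<noteq> 0"
    using arg_cong[OF t1, of "\<lambda>x. x = 0"] by auto
  have ch: "cosh w \<noteq> 0"
    using assms by (auto simp: tanh_def)
  have "sinh w / cosh w = sinh 1 / cosh 1"
    using assms t1 by (simp only: tanh_def[of w])
  then have "sinh (w - 1) = 0"
    using ch ch1 by (simp add: sinh_diff field_simps)
  then have "cmod (exp (w - 1)) = 1" unfolding sinh_zero_iff by (elim insertE) simp_all
  then have "Re w = 1" unfolding norm_exp_eq_Re by simp
  then show ?thesis using complex_Re_le_cmod[of w] by simp
qed

section \<open>Dilations and construction of members of \<open>starlike_class\<close>\<close>

lemma log_quotient_scale:
  assumes "f holomorphic_on unit_disk" "0 < r" "r \<le> 1" "z \<in> unit_disk"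
  shows "((\<lambda>z. f (of_real r * z) / of_real r) has_field_derivative deriv f (of_real r * z)) (at z)"
    and "log_quotient (\<lambda>z. f (of_real r * z) / of_real r) z = log_quotient f (of_real r * z)"
proof -
  have "cmod (of_real r * z) < 1"
    using assms mult_mono[of r 1 "cmod z" "cmod z"] by (auto simp: norm_mult)
  then have "(f has_field_derivative deriv f (of_real r * z)) (at (of_real r * z))"
    using assms by (intro holomorphic_derivI[of f unit_disk]) auto
  then have "((\<lambda>z. f (of_real r * z)) has_field_derivative deriv f (of_real r * z) * of_real r) (at z)"
    by (rule DERIV_chain2) (auto intro!: derivative_eq_intros)
  then have "((\<lambda>z. f (of_real r * z) / of_real r) has_field_derivative
      deriv f (of_real r * z) * of_real r / of_real r) (at z)"
    by (rule DERIV_cdivide)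
  then show D: "((\<lambda>z. f (of_real r * z) / of_real r) has_field_derivative deriv f (of_real r * z)) (at z)"
    using assms by simp
  show "log_quotient (\<lambda>z. f (of_real r * z) / of_real r) z = log_quotient f (of_real r * z)"
    using assms DERIV_imp_deriv[OF D] by (simp add: log_quotient_def)
qed

lemma starlike_class_scale:
  assumes f: "f \<in> starlike_class \<phi>" and r: "0 < r" "r \<le> 1"
    and sub: "\<And>\<omega>. \<omega> holomorphic_on unit_disk \<Longrightarrow> \<omega> ` unit_disk \<subseteq> unit_disk \<Longrightarrow> \<omega> 0 = 0 \<Longrightarrow>
                subordinate (\<lambda>z. \<phi> (\<omega> (of_real r * z))) \<psi>"
  shows "(\<lambda>z. f (of_real r * z) / of_real r) \<in> starlike_class \<psi>"
proof -
  from f have hol: "f holomorphic_on unit_disk" and f0: "f 0 = 0" "deriv f 0 = 1"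
    and nz: "\<And>z. z \<in> unit_disk - {0} \<Longrightarrow> f z \<noteq> 0"
    and "subordinate (log_quotient f) \<phi>"
    by (auto simp: starlike_class_def class_A_def)
  then obtain \<omega> where \<omega>: "\<omega> holomorphic_on unit_disk" "\<omega> ` unit_disk \<subseteq> unit_disk" "\<omega> 0 = 0"
    and eq: "\<And>z. z \<in> unit_disk \<Longrightarrow> log_quotient f z = \<phi> (\<omega> z)"
    unfolding subordinate_def by blast
  have in_disk: "of_real r * z \<in> unit_disk" if "z \<in> unit_disk" for z :: complex
    using that r mult_mono[of r 1 "cmod z" "cmod z"] by (auto simp: norm_mult)
  note scale = log_quotient_scale[OF hol r]
  have "(\<lambda>z. f (of_real r * z) / of_real r) holomorphic_on unit_disk"
    unfolding holomorphic_on_open[OF open_ball] using scale(1) by blast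
  then have "(\<lambda>z. f (of_real r * z) / of_real r) \<in> class_A"
    using DERIV_imp_deriv[OF scale(1)[of 0]] f0 by (simp add: class_A_def)
  moreover have "subordinate (log_quotient (\<lambda>z. f (of_real r * z) / of_real r)) \<psi>"
    using sub[OF \<omega>] scale(2) eq in_disk unfolding subordinate_def by metis
  ultimately show ?thesis
    using nz in_disk r by (auto simp: starlike_class_def)
qed

text \<open>Solves z f'/f = q by f(z) = z exp(P(z)), where P is the primitive of (q(z) - 1)/z with
  P(0) = 0. This supplies the extremal function.\<close>

lemma starlike_class_exists_log_quotient:
  assumes hol: "q holomorphic_on unit_disk" and q0: "q 0 = 1" and sub: "subordinate q \<phi>"
  obtains f where "f \<in> starlike_class \<phi>" "\<And>z. z \<in> unit_disk \<Longrightarrow> log_quotient f z = q z"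
proof -
  \<comment> \<open>The value at 0 fills the removable singularity of the difference
    quotient.\<close>
  define p where "p z = (if z = 0 then deriv q 0 else (q z - q 0) / (z - 0))" for z
  have "p holomorphic_on unit_disk"
    using pole_lemma[OF hol, of 0] by (simp add: p_def[abs_def] interior_open)
  then obtain H where H: "\<And>z. z \<in> unit_disk \<Longrightarrow> (H has_field_derivative p z) (at z within unit_disk)"
    using holomorphic_convex_primitive'[of unit_disk p] by auto
  define f where "f z = z * exp (H z - H 0)" for z
  have zp: "z * p z = q z - 1" for z by (simp add: p_def q0)
  have f: "(f has_field_derivative q z * exp (H z - H 0)) (at z)" if "z \<in> unit_disk" for z
  proof -
    have "(H has_field_derivative p z) (at z)"
      using H[OF that] that by (metis at_within_open open_ball)
    then have "(f has_field_derivative (1 + z * p z) * exp (H z - H 0)) (at z)"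
      unfolding f_def[abs_def] by (auto intro!: derivative_eq_intros simp: algebra_simps)
    then show ?thesis by (simp add: zp)
  qed
  have lq: "log_quotient f z = q z" if "z \<in> unit_disk" for z
    using DERIV_imp_deriv[OF f[OF that]] by (auto simp: log_quotient_def q0 f_def)
  have "f holomorphic_on unit_disk"
    unfolding holomorphic_on_open[OF open_ball] using f by blast
  then have "f \<in> class_A"
    using DERIV_imp_deriv[OF f[of 0]] by (simp add: class_A_def q0) (simp add: f_def)
  moreover have "subordinate (log_quotient f) \<phi>"
    using sub lq by (auto simp: subordinate_def)
  ultimately have "f \<in> starlike_class \<phi>"
    by (auto simp: starlike_class_def f_def)
  with lq show thesis by (rule that[rotated])
qed

section \<open>Attainment of the radius and its sharpness\<close>

lemma phi_S_scale_subordinate_phi_tanh: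
  assumes hol: "\<omega> holomorphic_on unit_disk" and maps: "\<omega> ` unit_disk \<subseteq> unit_disk" and "\<omega> 0 = 0"
  shows "subordinate (\<lambda>z. phi_S (\<omega> (of_real (arcsin (tanh 1)) * z))) phi_tanh"
proof -
  define r :: real where "r = arcsin (tanh 1)"
  have r: "0 < r" "r \<le> 1" "r < pi / 2" "sin r = tanh 1"
    using arcsin_tanh_1_pos arcsin_tanh_1_le_1 arcsin_tanh_1_less_pi_half tanh_real_bounds[of 1]
    by (auto simp: r_def)
  obtain g where g: "g holomorphic_on ball 0 (pi / 2)" "g 0 = 0"
    "\<And>w. w \<in> ball 0 (pi / 2) \<Longrightarrow> tanh (g w) = sin w"
    "\<And>w. w \<in> ball 0 (pi / 2) \<Longrightarrow> cmod (g w) \<le> artanh (sin (cmod w))"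
    by (rule artanh_sin_branch) blast
  define v where "v z = \<omega> (of_real r * z)" for z
  have rz: "cmod (of_real r * z) < r" if "z \<in> unit_disk" for z :: complex
    using that r by (simp add: norm_mult)
  \<comment> \<open>The Schwarz lemma bounds the norm of \<open>\<omega>\<close> at
    \<open>r * z\<close> by that of \<open>r * z\<close>, which is below \<open>r\<close>.\<close>
  have v: "cmod (v z) < r" if "z \<in> unit_disk" for z
    unfolding v_def using Schwarz_Lemma(1)[OF hol \<open>\<omega> 0 = 0\<close>, of "of_real r * z"] maps rz[OF that] r(2)
    by (force simp: image_subset_iff)
  have v_ball: "v z \<in> ball 0 (pi / 2)" if "z \<in> unit_disk" for z
    using v[OF that] r by simp
  have "v holomorphic_on unit_disk"
    unfolding v_def using rz r
    by (intro holomorphic_on_compose_gen[OF _ hol, unfolded o_def] holomorphic_intros) force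
  then have "(\<lambda>z. g (v z)) holomorphic_on unit_disk"
    using v_ball by (intro holomorphic_on_compose_gen[OF _ g(1), unfolded o_def]) auto
  moreover have "cmod (g (v z)) < 1" if z: "z \<in> unit_disk" for z
  proof -
    have "- (pi / 2) \<le> cmod (v z)" using norm_ge_zero[of "v z"] pi_gt_zero by linarith
    then have "sin (cmod (v z)) < sin r"
      using v[OF z] r by (intro sin_monotone_2pi) auto
    moreover have "- 1 < sin (cmod (v z))"
      using v[OF z] r abs_sin_less_1[of "cmod (v z)"] by auto
    ultimately have "artanh (sin (cmod (v z))) < artanh (tanh 1)"
      using r tanh_real_lt_1[of 1] by (intro artanh_real_strict_mono) auto
    then show ?thesis using g(4)[OF v_ball[OF z]] by (simp add: artanh_tanh_real)
  qed
  moreover have "g (v 0) = 0" by (simp add: v_def \<open>\<omega> 0 = 0\<close> g(2))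
  moreover have "phi_S (v z) = phi_tanh (g (v z))" if "z \<in> unit_disk" for z
    using g(3)[OF v_ball[OF that]] by (simp add: phi_S_def phi_tanh_def)
  ultimately show ?thesis
    unfolding subordinate_def r_def[symmetric] v_def[symmetric]
    by (intro exI[of _ "\<lambda>z. g (v z)"]) (auto simp: image_subset_iff)
qed

theorem theorem7p12:
  shows "starlike_radius phi_tanh phi_S = arcsin (tanh 1)"
  unfolding starlike_radius_def
\<comment> \<open>The supremum is a maximum: the value itself is admissible, and no larger
  \<open>r\<close> is.\<close>
proof (rule cSup_eq_maximum)
  show "arcsin (tanh 1) \<in> {r. 0 < r \<and> r \<le> 1 \<and>
      (\<forall>f\<in>starlike_class phi_S. (\<lambda>z. f (of_real r * z) / of_real r) \<in> starlike_class phi_tanh)}"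
    using arcsin_tanh_1_pos arcsin_tanh_1_le_1
    by (auto intro: starlike_class_scale phi_S_scale_subordinate_phi_tanh)
next
  fix r :: real
  assume "r \<in> {r. 0 < r \<and> r \<le> 1 \<and>
      (\<forall>f\<in>starlike_class phi_S. (\<lambda>z. f (of_real r * z) / of_real r) \<in> starlike_class phi_tanh)}"
  then have r: "0 < r" "r \<le> 1"
    and all: "\<And>f. f \<in> starlike_class phi_S \<Longrightarrow>
      (\<lambda>z. f (of_real r * z) / of_real r) \<in> starlike_class phi_tanh" by auto
  \<comment> \<open>The extremal \<open>f\<close> has \<open>phi_S\<close> itself as its logarithmic
    quotient.\<close>
  have "phi_S holomorphic_on unit_disk" "phi_S 0 = 1" "subordinate phi_S phi_S"
    unfolding phi_S_def[abs_def] subordinate_def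
    by (auto intro!: holomorphic_intros exI[of _ "\<lambda>z. z"])
  then obtain f where f: "f \<in> starlike_class phi_S"
    and lq: "\<And>z. z \<in> unit_disk \<Longrightarrow> log_quotient f z = phi_S z"
    by (rule starlike_class_exists_log_quotient) blast
  have hol: "f holomorphic_on unit_disk" using f by (simp add: starlike_class_def class_A_def)
  obtain \<omega> where \<omega>: "\<omega> ` unit_disk \<subseteq> unit_disk"
    and eq: "\<And>z. z \<in> unit_disk \<Longrightarrow>
      log_quotient (\<lambda>z. f (of_real r * z) / of_real r) z = phi_tanh (\<omega> z)"
    using all[OF f] by (auto simp: starlike_class_def subordinate_def)
  show "r \<le> arcsin (tanh 1)"
  proof (rule ccontr)
    assume less: "\<not> r \<le> arcsin (tanh 1)"
    \<comment> \<open>Chosen so that \<open>r * z\<close> is \<open>arcsin (tanh 1)\<close>, where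
      \<open>sin\<close> equals \<open>tanh 1\<close>. It lies in the disk exactly because
      \<open>r\<close> is assumed too large.\<close>
    define z :: complex where "z = of_real (arcsin (tanh 1) / r)"
    have rz: "of_real r * z = of_real (arcsin (tanh 1))" using r by (simp add: z_def)
    have z: "z \<in> unit_disk" using less r arcsin_tanh_1_pos by (simp add: z_def norm_divide)
    have "of_real (arcsin (tanh 1)) \<in> unit_disk"
      using less r arcsin_tanh_1_pos by simp
    then have "phi_tanh (\<omega> z) = phi_S (of_real (arcsin (tanh 1)))"
      using eq[OF z] log_quotient_scale(2)[OF hol r z] lq by (simp add: rz)
    then have "tanh (\<omega> z) = of_real (tanh 1)"
      using tanh_real_bounds[of 1] by (simp add: phi_tanh_def phi_S_def sin_of_real)
    then have "1 \<le> cmod (\<omega> z)" by (rule norm_ge_1_if_tanh_eq_tanh_1)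
    moreover have "\<omega> z \<in> unit_disk" using \<omega> z by blast
    ultimately show False by simp
  qed
qed

end
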